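(* Let $G$ be a $2$-connected graph on $n\geq 5$ vertices. Then $F(G)\geq F(C_n)$, with equality if and only if $G$ is isomorphic to $C_n$.
   Context: All graphs are finite, simple and undirected. A graph is $2$-connected if it is connected, has at least three vertices and has no cut-vertex. $C_n$ is the cycle on $n$ vertices. A connected subgraph of a graph $G=(V,E)$ is a graph $(V',E')$ with $\emptyset\neq V'\subseteq V$, $E'\subseteq E$, every edge of $E'$ having both endpoints in $V'$, and $(V',E')$ connected; distinct pairs $(V',E')$ are counted separately. The core index $F(G)$ is the number of connected subgraphs of $G$. *)

theory Defs
  imports "Graph_Theory.Graph_Theory"
begin

text \<open>
  A finite simple undirected graph is a \<^const>\<open>pair_graph\<close>: an undirected edge $uv$ is represented
  by the two arcs $(u,v)$ and $(v,u)$.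
\<close>

text \<open>
  A cut-vertex separates two other vertices of the same component; the graph itself need not be
  connected.
\<close>

definition cut_vertex :: "'a pair_pre_digraph \<Rightarrow> 'a \<Rightarrow> bool" where
  "cut_vertex G v \<longleftrightarrow> v \<in> pverts G \<and>
     (\<exists>u \<in> pverts G - {v}. \<exists>w \<in> pverts G - {v}.
        u \<rightarrow>\<^sup>*\<^bsub>with_proj G\<^esub> w \<and> \<not> u \<rightarrow>\<^sup>*\<^bsub>pre_digraph.del_vert (with_proj G) v\<^esub> w)"

definition two_connected :: "'a pair_pre_digraph \<Rightarrow> bool" where
  "two_connected G \<longleftrightarrow> connected (with_proj G) \<and> 3 \<le> card (pverts G) \<and> (\<nexists>v. cut_vertex G v)"

text \<open>
  Meant for $n \geq 3$: for $n = 1$ the definition yields a loop, for $n = 2$ a single edge.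
\<close>

definition cycle_graph :: "nat \<Rightarrow> nat pair_pre_digraph" where
  "cycle_graph n =
     \<lparr> pverts = {..<n},
       parcs = {(u, v). u < n \<and> v < n \<and> (v = Suc u mod n \<or> u = Suc v mod n)} \<rparr>"

lemma pair_graph_cycle_graph:
  assumes "3 \<le> n"
  shows "pair_graph (cycle_graph n)"
proof -
  have "finite (parcs (cycle_graph n))"
    by (rule finite_subset[of _ "{..<n} \<times> {..<n}"]) (auto simp: cycle_graph_def)
  moreover have "Suc u mod n \<noteq> u" "u \<noteq> Suc u mod n" if "u < n" for u
    using that assms by (cases "Suc u = n"; auto)+
  ultimately show ?thesis
    by unfold_locales (auto simp: cycle_graph_def symmetric_def arcs_ends_def arc_to_ends_def
        intro!: symI)
qed

text \<open>
  Requiring \<^prop>\<open>pair_graph H\<close> makes the arc set of \<open>H\<close> symmetric, so that the subgraphs counted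
  here are exactly the pairs $(V',E')$ with undirected edge set $E'$. Nonemptiness of $V'$ is part
  of \<^const>\<open>connected\<close>.
\<close>

definition connected_subgraphs :: "'a pair_pre_digraph \<Rightarrow> 'a pair_pre_digraph set" where
  "connected_subgraphs G =
     {H. pair_graph H \<and> subgraph (with_proj H) (with_proj G) \<and> connected (with_proj H)}"

definition core_index :: "'a pair_pre_digraph \<Rightarrow> nat" where
  "core_index G = card (connected_subgraphs G)"

lemma finite_connected_subgraphs:
  assumes "pair_graph G"
  shows "finite (connected_subgraphs G)"
proof -
  interpret pair_graph G by fact
  have "connected_subgraphs G \<subseteq>
      (\<lambda>(V, A). \<lparr> pverts = V, parcs = A \<rparr>) ` (Pow (pverts G) \<times> Pow (parcs G))"
  proof
    fix H assume "H \<in> connected_subgraphs G"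
    then have "(pverts H, parcs H) \<in> Pow (pverts G) \<times> Pow (parcs G)"
      by (auto simp: connected_subgraphs_def subgraph_def)
    then show "H \<in> (\<lambda>(V, A). \<lparr> pverts = V, parcs = A \<rparr>) ` (Pow (pverts G) \<times> Pow (parcs G))"
      by (rule rev_image_eqI) simp
  qed
  then show ?thesis
    by (rule finite_subset) (use pair_finite_verts pair_finite_arcs in simp)
qed

end

theory Submission
  imports Defs
begin

text \<open>
  The cycle has at most \<open>n\<^sup>2 + 1\<close> connected subgraphs: itself and its arcs, each given by a start
  vertex and a length below \<open>n\<close>. Conversely, build \<open>G\<close> from an edge by successively adding ears.
  Let \<open>H\<close> be connected on \<open>m\<close> vertices and add an ear with \<open>l \<ge> 1\<close> inner vertices and ends
  \<open>u \<noteq> v\<close>. Each of \<open>u\<close> and \<open>v\<close> lies in at least \<open>m\<close> connected subgraphs of \<open>H\<close>, one for every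
  order, and each of these can be prolonged into the ear in \<open>l\<close> ways: \<open>2 m l\<close> new subgraphs. There are
  \<open>l (l + 1) / 2\<close> subpaths inside the ear, \<open>l (l - 1) / 2\<close> ways of removing a middle piece of the ear
  from \<open>H\<close> plus ear, and \<open>H\<close> plus ear itself. So the count grows by at least
  \<open>2 m l + l\<^sup>2 + 1 > (m + l)\<^sup>2 - m\<^sup>2\<close>. The edge we start from has only \<open>3\<close> connected
  subgraphs, but closing it to a cycle also yields the spanning path without this edge, which brings
  the count to \<open>n\<^sup>2 + 1\<close>; every later ear or extra edge then makes the inequality strict.
\<close>

section \<open>Connected subgraphs of a symmetric relation\<close>

text \<open>Edges are kept as symmetric arc sets, so reachability is plain \<open>rtrancl\<close>.
  Loops are not excluded here; subgraphs of a pair graph inherit irreflexivity from it.\<close>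

definition conn_on :: "'a set \<Rightarrow> 'a rel \<Rightarrow> bool" where
  "conn_on W F \<longleftrightarrow> W \<noteq> {} \<and> F \<subseteq> W \<times> W \<and> sym F \<and> (\<forall>a\<in>W. \<forall>b\<in>W. (a, b) \<in> F\<^sup>*)"

definition csub :: "'a set \<Rightarrow> 'a rel \<Rightarrow> ('a set \<times> 'a rel) set" where
  "csub V E = {(W, F). W \<subseteq> V \<and> F \<subseteq> E \<and> conn_on W F}"

text \<open>The edges are selected by a set of indices rather than an interval, so that an ear with
  a middle piece removed has this form too.\<close>

definition path_arcs :: "(nat \<Rightarrow> 'a) \<Rightarrow> nat set \<Rightarrow> 'a rel" where
  "path_arcs p K = (\<Union>k\<in>K. {(p k, p (Suc k)), (p (Suc k), p k)})"

lemma finite_csub: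
  assumes "finite V" "finite E"
  shows "finite (csub V E)"
  by (rule finite_subset[of _ "Pow V \<times> Pow E"]) (use assms in \<open>auto simp: csub_def\<close>)

lemma conn_on_rootI:
  assumes "r \<in> W" "F \<subseteq> W \<times> W" "sym F" "\<And>b. b \<in> W \<Longrightarrow> (r, b) \<in> F\<^sup>*"
  shows "conn_on W F"
  unfolding conn_on_def
proof (intro conjI ballI)
  fix a b assume "a \<in> W" "b \<in> W"
  then have "(r, a) \<in> F\<^sup>*" "(r, b) \<in> F\<^sup>*" using assms(4) by auto
  moreover have "sym (F\<^sup>*)" using \<open>sym F\<close> by (rule sym_rtrancl)
  ultimately show "(a, b) \<in> F\<^sup>*" by (meson rtrancl_trans symD)
qed (use assms in auto)

lemma conn_on_finite: "conn_on W F \<Longrightarrow> finite W \<Longrightarrow> finite F"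
  unfolding conn_on_def by (meson finite_SigmaI finite_subset)

lemma conn_on_singleton: "conn_on {x} {}"
  by (auto simp: conn_on_def)

lemma conn_on_edge: "conn_on {x, y} {(x, y), (y, x)}"
  by (rule conn_on_rootI[of x]) (auto simp: sym_def)

lemma conn_on_mono:
  assumes "conn_on W F" "F \<subseteq> F'" "F' \<subseteq> W \<times> W" "sym F'"
  shows "conn_on W F'"
  using assms rtrancl_mono[OF assms(2)] unfolding conn_on_def by blast

lemma conn_on_Un:
  assumes "conn_on W F" "conn_on W' F'" "x \<in> W" "x \<in> W'"
  shows "conn_on (W \<union> W') (F \<union> F')"
proof (rule conn_on_rootI[of x])
  have "F\<^sup>* \<subseteq> (F \<union> F')\<^sup>*" "F'\<^sup>* \<subseteq> (F \<union> F')\<^sup>*"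
    by (simp_all add: rtrancl_mono)
  then show "(x, b) \<in> (F \<union> F')\<^sup>*" if "b \<in> W \<union> W'" for b
    using that assms unfolding conn_on_def by blast
qed (use assms in \<open>auto simp: conn_on_def intro: sym_Un\<close>)

text \<open>Otherwise a walk from \<open>a\<close> could never leave \<open>W\<close> and would not
  reach \<open>b\<close>.\<close>

lemma conn_on_crossing:
  assumes "conn_on V E" "a \<in> V" "a \<in> W" "b \<in> V" "b \<notin> W"
  obtains x y where "x \<in> W" "y \<notin> W" "(x, y) \<in> E"
proof -
  have "(a, b) \<in> E\<^sup>*" using assms by (auto simp: conn_on_def)
  then have "b \<in> W" if "\<And>x y. x \<in> W \<Longrightarrow> (x, y) \<in> E \<Longrightarrow> y \<in> W"
    by induction (use that assms in auto)
  then show ?thesis using assms that by blast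
qed

section \<open>Paths along a sequence of vertices\<close>

lemma path_arcs_mono: "K \<subseteq> K' \<Longrightarrow> path_arcs p K \<subseteq> path_arcs p K'"
  by (auto simp: path_arcs_def)

lemma path_arcs_empty [simp]: "path_arcs p {} = {}"
  by (simp add: path_arcs_def)

lemma path_arcs_Un: "path_arcs p (K \<union> K') = path_arcs p K \<union> path_arcs p K'"
  by (simp add: path_arcs_def)

lemma path_arcs_insert:
  "path_arcs p (insert k K) = {(p k, p (Suc k)), (p (Suc k), p k)} \<union> path_arcs p K"
  by (simp add: path_arcs_def)

lemma conn_on_path:
  assumes "i \<le> j"
  shows "conn_on (p ` {i..j}) (path_arcs p {i..<j})"
  using assms
proof (induction j rule: dec_induct)
  case base
  show ?case by (simp add: conn_on_singleton)
next
  case (step j)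
  have "conn_on (p ` {i..j} \<union> {p j, p (Suc j)})
      (path_arcs p {i..<j} \<union> {(p j, p (Suc j)), (p (Suc j), p j)})"
    using step by (intro conn_on_Un[of _ _ _ _ "p j"] conn_on_edge) auto
  moreover have "p ` {i..j} \<union> {p j, p (Suc j)} = p ` {i..Suc j}"
    using step by (auto simp: atLeastAtMostSuc_conv)
  moreover have "path_arcs p {i..<j} \<union> {(p j, p (Suc j)), (p (Suc j), p j)} = path_arcs p {i..<Suc j}"
    using step by (auto simp: atLeastLessThanSuc path_arcs_insert)
  ultimately show ?case by simp
qed

text \<open>Growth from \<open>{u}\<close>: as long as a vertex is missing, a crossing arc supplies
  one more. This is the source of the factor \<open>m\<close> in the count of prolongations.\<close>

lemma conn_on_induced_subset:
  assumes "conn_on V E" "u \<in> V" "finite V" "1 \<le> k" "k \<le> card V"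
  shows "\<exists>W \<subseteq> V. u \<in> W \<and> card W = k \<and> conn_on W (E \<inter> W \<times> W)"
  using \<open>1 \<le> k\<close> \<open>k \<le> card V\<close>
proof (induction k rule: dec_induct)
  case base
  have "conn_on {u} (E \<inter> {u} \<times> {u})"
    using assms by (intro conn_on_mono[OF conn_on_singleton]) (auto simp: conn_on_def sym_def)
  then show ?case using assms by (intro exI[of _ "{u}"]) auto
next
  case (step k)
  then obtain W where W: "W \<subseteq> V" "u \<in> W" "card W = k" "conn_on W (E \<inter> W \<times> W)" by auto
  then obtain b where b: "b \<in> V" "b \<notin> W" using step by (metis Suc_n_not_le_n subsetI subset_antisym)
  obtain x y where xy: "x \<in> W" "y \<notin> W" "(x, y) \<in> E"
    using conn_on_crossing[OF assms(1,2) W(2) b] by blast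
  have E: "(y, x) \<in> E" "y \<in> V" "sym E" using assms(1) xy by (auto simp: conn_on_def dest: symD)
  have "conn_on (insert y W) (E \<inter> W \<times> W \<union> {(x, y), (y, x)})"
    using conn_on_Un[OF W(4) conn_on_edge[of x y], of x] xy by (simp add: insert_absorb)
  then have "conn_on (insert y W) (E \<inter> insert y W \<times> insert y W)"
    by (rule conn_on_mono) (use E xy in \<open>auto simp: sym_def\<close>)
  moreover have "card (insert y W) = Suc k"
    using W xy finite_subset[OF W(1) assms(3)] by simp
  ultimately show ?case using W E by (intro exI[of _ "insert y W"]) auto
qed

text \<open>All old subgraphs survive, and the new edge with its ends is a further one.\<close>

lemma card_csub_insert_edge:
  assumes "finite V" "finite E" "u \<in> V" "v \<in> V" "(u, v) \<notin> E"
  shows "card (csub V E) < card (csub V (E \<union> {(u, v), (v, u)}))"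
proof (rule psubset_card_mono)
  show "finite (csub V (E \<union> {(u, v), (v, u)}))" using assms by (intro finite_csub) auto
  have "({u, v}, {(u, v), (v, u)}) \<in> csub V (E \<union> {(u, v), (v, u)}) - csub V E"
    using assms by (auto simp: csub_def conn_on_edge)
  moreover have "csub V E \<subseteq> csub V (E \<union> {(u, v), (v, u)})" by (auto simp: csub_def)
  ultimately show "csub V E \<subset> csub V (E \<union> {(u, v), (v, u)})" by blast
qed

section \<open>Adding an ear\<close>

lemma conn_on_ear:
  assumes "conn_on V E" "p 0 \<in> V"
    and "p (Suc l) \<in> V"
  shows "conn_on (V \<union> p ` {1..l}) (E \<union> path_arcs p {0..l})"
proof -
  have "conn_on (V \<union> p ` {0..Suc l}) (E \<union> path_arcs p {0..<Suc l})"
    by (rule conn_on_Un[OF assms(1) conn_on_path assms(2)]) auto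
  moreover have "V \<union> p ` {0..Suc l} = V \<union> p ` {1..l}"
  proof -
    have "{0..Suc l} = {0, Suc l} \<union> {1..l}" by auto
    then show ?thesis using assms by auto
  qed
  ultimately show ?thesis by (simp add: atLeastLessThanSuc_atLeastAtMost)
qed

lemma conn_on_ear_start:
  assumes "conn_on W F" "p 0 \<in> W"
  shows "conn_on (W \<union> p ` {1..i}) (F \<union> path_arcs p {..<i})"
proof -
  have "conn_on (W \<union> p ` {0..i}) (F \<union> path_arcs p {0..<i})"
    by (rule conn_on_Un[OF assms(1) conn_on_path assms(2)]) auto
  moreover have "W \<union> p ` {0..i} = W \<union> p ` {1..i}"
  proof -
    have "{0..i} = {0} \<union> {1..i}" by auto
    then show ?thesis using assms by auto
  qed
  ultimately show ?thesis by (simp add: atLeast0LessThan)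
qed

text \<open>The edge with index \<open>l\<close> joins \<open>p l\<close> to the end
  \<open>p (Suc l)\<close>, so prolonging backwards to \<open>p j\<close> uses the same index range
  for vertices and edges.\<close>

lemma conn_on_ear_end:
  assumes "conn_on W F" "p (Suc l) \<in> W" "j \<le> l"
  shows "conn_on (W \<union> p ` {j..l}) (F \<union> path_arcs p {j..l})"
proof -
  have "conn_on (W \<union> p ` {j..Suc l}) (F \<union> path_arcs p {j..<Suc l})"
    by (rule conn_on_Un[OF assms(1) conn_on_path assms(2)]) (use assms in auto)
  moreover have "W \<union> p ` {j..Suc l} = W \<union> p ` {j..l}"
  proof -
    have "{j..Suc l} = {Suc l} \<union> {j..l}" using assms by auto
    then show ?thesis using assms by auto
  qed
  ultimately show ?thesis by (simp add: atLeastLessThanSuc_atLeastAtMost)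
qed

text \<open>By injectivity an ear edge determines its index, so \<open>K\<close> can be read off
  from the arcs.\<close>

lemma ear_path_arcs_iff:
  assumes "inj_on p {0..Suc l}" "K \<subseteq> {0..l}" "k \<le> l"
  shows "(p k, p (Suc k)) \<in> path_arcs p K \<longleftrightarrow> k \<in> K"
proof
  assume "(p k, p (Suc k)) \<in> path_arcs p K"
  then obtain m where m: "m \<in> K" "p k = p m \<and> p (Suc k) = p (Suc m) \<or> p k = p (Suc m) \<and> p (Suc k) = p m"
    by (auto simp: path_arcs_def)
  moreover have "p a = p b \<longleftrightarrow> a = b" if "a \<le> Suc l" "b \<le> Suc l" for a b
    using assms(1) that by (auto simp: inj_on_eq_iff)
  moreover have "m \<le> l" using m assms by auto
  ultimately show "k \<in> K" using assms(3) by auto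
qed (auto simp: path_arcs_def)

text \<open>Every ear edge has an inner vertex: \<open>p 1\<close> for index \<open>0\<close>, and
  \<open>p k\<close> for any later index \<open>k\<close>.\<close>

lemma ear_path_arcs_disjoint:
  assumes "1 \<le> l" "\<And>i. i \<in> {1..l} \<Longrightarrow> p i \<notin> V" "K \<subseteq> {0..l}"
  shows "path_arcs p K \<inter> V \<times> V = {}"
proof -
  have "p k \<notin> V \<or> p (Suc k) \<notin> V" if "k \<in> K" for k
    using assms(1,3) assms(2)[of k] assms(2)[of "Suc k"] that by (cases "k = 0") auto
  then show ?thesis by (auto simp: path_arcs_def)
qed

text \<open>The removed pair carries only the ear edges and is avoided by all families counted. Over
  a single edge it is the spanning path, which can thus be counted separately.\<close>

lemma card_csub_ear:
  assumes conn: "conn_on V E" and fin: "finite V" and ne: "E \<noteq> {}" and l: "1 \<le> l"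
    and inj: "inj_on p {0..Suc l}" and ends: "p 0 \<in> V" "p (Suc l) \<in> V"
    and out: "\<And>i. i \<in> {1..l} \<Longrightarrow> p i \<notin> V"
  shows "card (csub V E) + 2 * l * card V + l * l + 1 \<le>
    card (csub (V \<union> p ` {1..l}) (E \<union> path_arcs p {0..l}) - {(V \<union> p ` {1..l}, path_arcs p {0..l})})"
    (is "_ \<le> card (?T - {?X})")
proof -
  define N where "N = card V"
  \<comment> \<open>\<open>q\<close> decodes a quadruple into a subgraph. Since it is injective on
    \<open>D\<close>, families can be counted and kept apart on the level of codes.\<close>
  define q where "q = (\<lambda>(W, F, J, K). (W \<union> p ` J, F \<union> path_arcs p K))"
  define D where "D = {(W, F, J, K). W \<subseteq> V \<and> F \<subseteq> E \<and> J \<subseteq> {1..l} \<and> K \<subseteq> {0..l}}"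
  have EV: "E \<subseteq> V \<times> V" and finE: "finite E"
    using conn conn_on_finite[OF conn fin] by (auto simp: conn_on_def)
  have arcs_disj: "path_arcs p K \<inter> V \<times> V = {}" if "K \<subseteq> {0..l}" for K
    by (rule ear_path_arcs_disjoint[where l = l and p = p and V = V]) (use l out that in auto)
  have inj_q: "inj_on q D"
  \<comment> \<open>An explicit left inverse: restriction to \<open>V\<close> recovers
    \<open>W\<close> and \<open>F\<close>; testing inner vertices and forward ear arcs recovers
    \<open>J\<close> and \<open>K\<close>.\<close>
  proof (rule inj_on_inverseI)
    fix x assume "x \<in> D"
    then obtain W F J K where x: "x = (W, F, J, K)" "W \<subseteq> V" "F \<subseteq> E" "J \<subseteq> {1..l}" "K \<subseteq> {0..l}"
      by (auto simp: D_def)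
    have "(W \<union> p ` J) \<inter> V = W" using x out by auto
    moreover have "(F \<union> path_arcs p K) \<inter> V \<times> V = F"
      using x arcs_disj[OF x(5)] EV by blast
    moreover have "{j \<in> {1..l}. p j \<in> W \<union> p ` J} = J"
    proof -
      have "p j \<in> p ` J \<longleftrightarrow> j \<in> J" if "j \<in> {1..l}" for j
        using x(4) that inj by (subst inj_on_image_mem_iff[of p "{0..Suc l}"]) auto
      then show ?thesis using x(2,4) out by blast
    qed
    moreover have "{k \<in> {0..l}. (p k, p (Suc k)) \<in> F \<union> path_arcs p K} = K"
    proof -
      have "(p k, p (Suc k)) \<notin> F" if "k \<le> l" for k
        using arcs_disj[of "{0..l}"] that x(3) EV unfolding path_arcs_def by fastforce
      then show ?thesis using x(5) ear_path_arcs_iff[OF inj x(5)] by auto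
    qed
    ultimately show "(\<lambda>(W, F). (W \<inter> V, F \<inter> V \<times> V, {j \<in> {1..l}. p j \<in> W},
        {k \<in> {0..l}. (p k, p (Suc k)) \<in> F})) (q x) = x"
      by (simp add: x(1) q_def)
  qed
  \<comment> \<open>Fix one connected induced subgraph of each order through each end of the
    ear.\<close>
  have "\<exists>c. \<forall>k\<in>{1..N}. c k \<subseteq> V \<and> u \<in> c k \<and> card (c k) = k \<and> conn_on (c k) (E \<inter> c k \<times> c k)"
    if "u \<in> V" for u
    by (rule bchoice) (use conn_on_induced_subset[OF conn that fin] in \<open>auto simp: N_def\<close>)
  then obtain cu cv where
    cu: "\<And>k. k \<in> {1..N} \<Longrightarrow> cu k \<subseteq> V \<and> p 0 \<in> cu k \<and> card (cu k) = k \<and> conn_on (cu k) (E \<inter> cu k \<times> cu k)"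
    and cv: "\<And>k. k \<in> {1..N} \<Longrightarrow> cv k \<subseteq> V \<and> p (Suc l) \<in> cv k \<and> card (cv k) = k \<and> conn_on (cv k) (E \<inter> cv k \<times> cv k)"
    using ends by meson
  \<comment> \<open>Quadruples \<open>(W, F, J, K)\<close> encode the part inside \<open>(V, E)\<close>, the inner ear vertices and the ear edges.
    Pairs \<open>i \<le> j\<close> in \<open>fB\<close> give subpaths of the ear, pairs \<open>j < i\<close> the whole graph with the piece of the
    ear between \<open>j\<close> and \<open>i\<close> removed; together they are \<open>l * l\<close> many.\<close>
  define fA where "fA = (\<lambda>(W, F). (W :: 'a set, F :: 'a rel, {} :: nat set, {} :: nat set))"
  define fB where "fB = (\<lambda>(i :: nat, j). if i \<le> j then ({}, {}, {i..j}, {i..<j})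
      else (V, E, {1..j} \<union> {i..l}, {..<j} \<union> {i..l}))"
  define fC where "fC = (\<lambda>(i :: nat, k). (cu k, E \<inter> cu k \<times> cu k, {1..i}, {..<i}))"
  define fD where "fD = (\<lambda>(j, k). (cv k, E \<inter> cv k \<times> cv k, {j..l}, {j..l}))"
  define A where "A = fA ` csub V E"
  define B where "B = fB ` ({1..l} \<times> {1..l})"
  define C where "C = fC ` ({1..l} \<times> {1..N})"
  define C' where "C' = fD ` ({1..l} \<times> {1..N})"
  define X where "X = {(V, E, {1..l}, {0..l})}"
  note fdefs = A_def B_def C_def C'_def X_def fA_def fB_def fC_def fD_def
  have finA: "finite A" "finite B" "finite C" "finite C'" "finite X"
    unfolding A_def B_def C_def C'_def X_def using finite_csub[OF fin finE] by auto
  have cardA: "card A = card (csub V E)"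
    unfolding A_def by (rule card_image) (auto simp: fA_def inj_on_def)
  have cardB: "card B = l * l"
  proof -
    have "inj_on fB ({1..l} \<times> {1..l})"
    proof (rule inj_onI, clarify)
      fix i j i' j' assume h: "i \<in> {1..l}" "j \<in> {1..l}" "i' \<in> {1..l}" "j' \<in> {1..l}" "fB (i, j) = fB (i', j')"
      \<comment> \<open>The first component, empty or \<open>V\<close>, reveals the branch of
        \<open>fB\<close>.\<close>
      have V: "V \<noteq> {}" using ends by auto
      show "i = i' \<and> j = j'"
      proof (cases "i \<le> j")
        case True
        then have "i' \<le> j'" "{i..j} = {i'..j'}" using h V by (auto simp: fB_def split: if_splits)
        then show ?thesis using True by (auto simp: Icc_eq_Icc)
      next
        case False
        then have f': "\<not> i' \<le> j'" and K: "{..<j} \<union> {i..l} = {..<j'} \<union> {i'..l}"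
          using h V by (auto simp: fB_def split: if_splits)
        \<comment> \<open>The missing edge indices form a nonempty interval, which determines
          \<open>j\<close> and \<open>i\<close>.\<close>
        have "{..l} - ({..<j} \<union> {i..l}) = {j..<i}" "{..l} - ({..<j'} \<union> {i'..l}) = {j'..<i'}"
          using h by auto
        then have "{j..<i} = {j'..<i'}" using K by simp
        then show ?thesis using False f' by (auto simp: atLeastLessThan_eq_iff)
      qed
    qed
    then show ?thesis unfolding B_def by (simp add: card_image)
  qed
  have cardC: "card C = l * N"
  proof -
    \<comment> \<open>Here \<open>i\<close> is read off from \<open>{1..i}\<close>, and
      \<open>k\<close> is the order of \<open>cu k\<close>.\<close>
    have "inj_on fC ({1..l} \<times> {1..N})"
      by (rule inj_onI) (use cu in \<open>auto simp: fC_def\<close>, metis atLeastAtMost_iff cu)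
    then show ?thesis unfolding C_def by (simp add: card_image)
  qed
  have cardC': "card C' = l * N"
  proof -
    have "inj_on fD ({1..l} \<times> {1..N})"
      by (rule inj_onI) (use cv in \<open>auto simp: fD_def Icc_eq_Icc\<close>, metis atLeastAtMost_iff cv)
    then show ?thesis unfolding C'_def by (simp add: card_image)
  qed
  \<comment> \<open>The families are told apart by whether \<open>J\<close> is empty, which of the
    end edges \<open>0\<close> and \<open>l\<close> lie in \<open>K\<close>, and whether
    \<open>K\<close> is all of \<open>{0..l}\<close>.\<close>
  have A: "fst (snd (snd x)) = {}" "\<not> {0..l} \<subseteq> snd (snd (snd x))" if "x \<in> A" for x
    using that by (auto simp: fdefs)
  have B: "fst (snd (snd x)) \<noteq> {}" "0 \<in> snd (snd (snd x)) \<longleftrightarrow> l \<in> snd (snd (snd x))"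
    "\<not> {0..l} \<subseteq> snd (snd (snd x))" if xB: "x \<in> B" for x
  proof -
    obtain i j where ij: "i \<in> {1..l}" "j \<in> {1..l}" "x = fB (i, j)" using xB by (auto simp: B_def)
    then show "fst (snd (snd x)) \<noteq> {}" "0 \<in> snd (snd (snd x)) \<longleftrightarrow> l \<in> snd (snd (snd x))"
      by (auto simp: fB_def)
    have "j \<notin> snd (snd (snd x))" using ij by (auto simp: fB_def)
    then show "\<not> {0..l} \<subseteq> snd (snd (snd x))" using ij by auto
  qed
  have C: "fst (snd (snd x)) \<noteq> {}" "0 \<in> snd (snd (snd x))" "l \<notin> snd (snd (snd x))" if "x \<in> C" for x
    using that by (auto simp: fdefs)
  have C': "fst (snd (snd x)) \<noteq> {}" "0 \<notin> snd (snd (snd x))" "l \<in> snd (snd (snd x))" if "x \<in> C'" for x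
    using that by (auto simp: fdefs)
  have X: "fst (snd (snd x)) \<noteq> {}" "0 \<in> snd (snd (snd x))" "l \<in> snd (snd (snd x))"
    "{0..l} \<subseteq> snd (snd (snd x))" if "x \<in> X" for x
    using that l by (auto simp: fdefs)
  have disj: "A \<inter> B = {}" "(A \<union> B) \<inter> C = {}" "(A \<union> B \<union> C) \<inter> C' = {}" "(A \<union> B \<union> C \<union> C') \<inter> X = {}"
    using A B C C' X by blast+
  have cardS: "card (A \<union> B \<union> C \<union> C' \<union> X) = card (csub V E) + 2 * l * card V + l * l + 1"
    using finA disj cardA cardB cardC cardC'
    by (simp add: card_Un_disjoint N_def X_def)
  have SD: "A \<union> B \<union> C \<union> C' \<union> X \<subseteq> D"
  proof -
    have "A \<subseteq> D" by (auto simp: A_def fA_def D_def csub_def)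
    moreover have "B \<subseteq> D" by (auto simp: B_def fB_def D_def split: if_splits)
    moreover have "fC (i, k) \<in> D" if "i \<in> {1..l}" "k \<in> {1..N}" for i k
      using cu[OF that(2)] that by (auto simp: fC_def D_def)
    then have "C \<subseteq> D" by (auto simp: C_def)
    moreover have "fD (i, k) \<in> D" if "i \<in> {1..l}" "k \<in> {1..N}" for i k
      using cv[OF that(2)] that by (auto simp: fD_def D_def)
    then have "C' \<subseteq> D" by (auto simp: C'_def)
    moreover have "X \<subseteq> D" by (auto simp: X_def D_def)
    ultimately show ?thesis by blast
  qed
  have SX: "?X \<notin> q ` (A \<union> B \<union> C \<union> C' \<union> X)"
  proof -
    \<comment> \<open>Only \<open>X\<close> uses the whole ear, and its code has \<open>E\<close>
      instead of the empty set as second component.\<close>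
    have "(V, {}, {1..l}, {0..l}) \<notin> A \<union> B \<union> C \<union> C' \<union> X"
      using A B C C' ne by (fastforce simp: X_def)
    moreover have "(V, {}, {1..l}, {0..l}) \<in> D" by (simp add: D_def)
    moreover have "q (V, {}, {1..l}, {0..l}) = ?X" by (simp add: q_def)
    ultimately show ?thesis using inj_on_image_mem_iff[OF inj_q _ SD] by metis
  qed
  have ST: "q ` (A \<union> B \<union> C \<union> C' \<union> X) \<subseteq> ?T"
  proof
    fix y assume "y \<in> q ` (A \<union> B \<union> C \<union> C' \<union> X)"
    then obtain x where x: "x \<in> A \<union> B \<union> C \<union> C' \<union> X" "y = q x" by blast
    obtain W F J K where wf: "x = (W, F, J, K)" by (metis prod.collapse)
    have "x \<in> D" using SD x(1) by (rule subsetD)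
    then have sub: "W \<union> p ` J \<subseteq> V \<union> p ` {1..l}" "F \<union> path_arcs p K \<subseteq> E \<union> path_arcs p {0..l}"
      unfolding wf using path_arcs_mono[of K "{0..l}" p] by (auto simp: D_def)
    consider "x \<in> A" | "x \<in> B" | "x \<in> C" | "x \<in> C'" | "x \<in> X" using x(1) by blast
    then have "conn_on (W \<union> p ` J) (F \<union> path_arcs p K)"
    proof cases
      case 1
      then show ?thesis by (auto simp: wf A_def fA_def csub_def)
    next
      case 2
      then obtain i j where ij: "i \<in> {1..l}" "j \<in> {1..l}" "x = fB (i, j)" by (auto simp: B_def)
      show ?thesis
      proof (cases "i \<le> j")
        case True
        then show ?thesis using ij conn_on_path[OF True, of p] by (simp add: wf fB_def)
      next
        case False
        have "conn_on (V \<union> p ` {1..j} \<union> p ` {i..l}) (E \<union> path_arcs p {..<j} \<union> path_arcs p {i..l})"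
          using ij ends by (intro conn_on_ear_end conn_on_ear_start conn) auto
        then show ?thesis using ij False by (simp add: wf fB_def path_arcs_Un image_Un Un_assoc)
      qed
    next
      case 3
      then obtain i k where ik: "k \<in> {1..N}" "x = fC (i, k)" by (auto simp: C_def)
      show ?thesis
        using conn_on_ear_start[of "cu k" "E \<inter> cu k \<times> cu k" p i] cu[OF ik(1)] ik(2)
        by (simp add: wf fC_def)
    next
      case 4
      then obtain j k where jk: "j \<in> {1..l}" "k \<in> {1..N}" "x = fD (j, k)" by (auto simp: C'_def)
      show ?thesis
        using conn_on_ear_end[of "cv k" "E \<inter> cv k \<times> cv k" p l j] cv[OF jk(2)] jk(1,3)
        by (simp add: wf fD_def)
    next
      case 5
      then show ?thesis using conn_on_ear[OF conn ends] by (simp add: wf X_def)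
    qed
    then show "y \<in> ?T" using sub by (auto simp: x(2) wf q_def csub_def)
  qed
  have "card (csub V E) + 2 * l * card V + l * l + 1 = card (q ` (A \<union> B \<union> C \<union> C' \<union> X))"
    using cardS inj_on_subset[OF inj_q SD] by (simp add: card_image)
  also have "\<dots> \<le> card (?T - {?X})"
  proof (rule card_mono)
    show "finite (?T - {?X})"
      using fin finE by (intro finite_Diff finite_csub) (auto simp: path_arcs_def)
  qed (use ST SX in auto)
  finally show ?thesis .
qed

section \<open>Ears in graphs without cut vertices\<close>

text \<open>For a connected graph this is the absence of cut-vertices, phrased so that a walk
  avoiding \<open>x\<close> is directly available.\<close>

definition cut_free :: "'a set \<Rightarrow> 'a rel \<Rightarrow> bool" where
  "cut_free V E \<longleftrightarrow> (\<forall>x\<in>V. \<forall>u\<in>V - {x}. \<forall>w\<in>V - {x}. (u, w) \<in> (E \<inter> (V - {x}) \<times> (V - {x}))\<^sup>*)"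

text \<open>Leave \<open>V0\<close> along an edge from \<open>x\<close> to \<open>y\<close>. As
  \<open>x\<close> is no cut-vertex, \<open>y\<close> can return to \<open>V0\<close> without
  passing through \<open>x\<close>, so the ends of the ear differ.\<close>

lemma ear_exists:
  assumes conn: "conn_on V E" and "V0 \<subseteq> V" "V0 \<noteq> V" "a \<in> V0" "b \<in> V0" "a \<noteq> b"
    and no_cut: "cut_free V E"
  obtains p l where "1 \<le> l" "inj_on p {0..Suc l}" "p 0 \<in> V0" "p (Suc l) \<in> V0"
    "p ` {1..l} \<subseteq> V - V0" "path_arcs p {0..l} \<subseteq> E"
proof -
  obtain c where c: "c \<in> V" "c \<notin> V0" using assms by blast
  obtain x y where xy: "x \<in> V0" "y \<notin> V0" "(x, y) \<in> E"
    using conn_on_crossing[OF conn _ assms(4) c] assms by blast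
  have EV: "E \<subseteq> V \<times> V" and symE: "sym E" using conn by (auto simp: conn_on_def)
  define R where "R = E \<inter> (V - {x}) \<times> (V - {x})"
  obtain z where z: "z \<in> V0" "z \<noteq> x" using assms by metis
  have "(y, z) \<in> R\<^sup>*" using no_cut xy z EV assms(2) unfolding R_def cut_free_def by blast
  then obtain k0 where "(y, z) \<in> R ^^ k0" by (meson rtrancl_imp_relpow)
  then have ex: "\<exists>k. \<exists>z\<in>V0. (y, z) \<in> R ^^ k" using z by blast
  \<comment> \<open>A shortest walk from \<open>y\<close> back to \<open>V0\<close> avoiding \<open>x\<close> has distinct vertices outside \<open>V0\<close>.\<close>
  define k where "k = (LEAST k. \<exists>z\<in>V0. (y, z) \<in> R ^^ k)"
  have "\<exists>z\<in>V0. (y, z) \<in> R ^^ k" unfolding k_def using ex by (rule LeastI_ex)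
  then obtain z' where z': "z' \<in> V0" "(y, z') \<in> R ^^ k" by blast
  have min: "k \<le> m" if "z \<in> V0" "(y, z) \<in> R ^^ m" for m z
    unfolding k_def by (rule Least_le) (use that in blast)
  obtain f where f: "f 0 = y" "f k = z'" "\<And>i. i < k \<Longrightarrow> (f i, f (Suc i)) \<in> R"
    using z'(2) by (auto simp: relpow_fun_conv)
  have "k \<noteq> 0" using f z' xy by metis
  have pre: "(y, f i) \<in> R ^^ i" if "i \<le> k" for i
    unfolding relpow_fun_conv using f that by (intro exI[of _ f]) auto
  have post: "(f i, z') \<in> R ^^ (k - i)" if "i \<le> k" for i
    unfolding relpow_fun_conv using f that by (intro exI[of _ "\<lambda>j. f (i + j)"]) auto
  \<comment> \<open>An earlier visit to \<open>V0\<close> would be a shorter return.\<close>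
  have out: "f i \<notin> V0" if "i < k" for i using min[of "f i" i] pre[of i] that by auto
  have inV: "f i \<in> V - {x}" if "i \<le> k" for i
  proof (cases "i = k")
    case True
    then show ?thesis using f(3)[of "k - 1"] \<open>k \<noteq> 0\<close> by (auto simp: R_def)
  next
    case False
    then show ?thesis using f(3)[of i] that by (auto simp: R_def)
  qed
  have less: "f i \<noteq> f j" if "i < j" "j \<le> k" for i j
  proof
    assume eq: "f i = f j"
    \<comment> \<open>Cutting out the closed piece between \<open>i\<close> and \<open>j\<close>
      shortens the walk.\<close>
    have "(y, z') \<in> R ^^ (i + (k - j))"
      unfolding relpow_add using pre[of i] post[of j] eq that by (intro relcompI[of _ "f j"]) auto
    then show False using min[OF z'(1)] that by fastforce
  qed
  have injf: "inj_on f {0..k}"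
    by (rule inj_onI) (metis atLeastAtMost_iff less linorder_neqE_nat)
  \<comment> \<open>Prefixing \<open>x\<close> shifts the walk by one: \<open>f 0\<close> to
    \<open>f (k - 1)\<close> become the inner vertices \<open>p 1\<close> to \<open>p k\<close>, and
    \<open>p (Suc k)\<close> is the point of return.\<close>
  define p where "p = (\<lambda>i. case i of 0 \<Rightarrow> x | Suc j \<Rightarrow> f j)"
  show ?thesis
  proof (rule that[of k p])
    show "1 \<le> k" using \<open>k \<noteq> 0\<close> by simp
    show "inj_on p {0..Suc k}"
    proof (rule inj_onI)
      fix i j assume "i \<in> {0..Suc k}" "j \<in> {0..Suc k}" "p i = p j"
      then show "i = j" using inV injf
        by (auto simp: p_def inj_on_def split: nat.splits)
    qed
    show "p 0 \<in> V0" "p (Suc k) \<in> V0" using xy f z' by (auto simp: p_def)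
    show "p ` {1..k} \<subseteq> V - V0"
      using out inV by (auto simp: p_def split: nat.splits)
    have "(p i, p (Suc i)) \<in> E" if "i \<le> k" for i
      using that xy f by (auto simp: p_def R_def split: nat.splits)
    then show "path_arcs p {0..k} \<subseteq> E"
      using symE by (force simp: path_arcs_def intro: symD)
  qed
qed

text \<open>Induction on the number of missing arcs. Adding one edge or one ear lifts the bound from
  more than the squared order to more than that plus one, so a single enlargement suffices and later
  ones preserve it.\<close>

lemma card_csub_gt_if_proper_subgraph:
  assumes conn: "conn_on V E" and fin: "finite V"
    and no_cut: "cut_free V E"
    and "V0 \<subseteq> V" "E0 \<subseteq> E" "conn_on V0 E0" "2 \<le> card V0"
    and "(card V0)\<^sup>2 < card (csub V0 E0)"
    and "(V0, E0) \<noteq> (V, E)"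
  shows "(card V)\<^sup>2 + 1 < card (csub V E)"
  using assms(4-)
proof (induction "card (E - E0)" arbitrary: V0 E0 rule: less_induct)
  case less
  have EV: "E \<subseteq> V \<times> V" and symE: "sym E" using conn by (auto simp: conn_on_def)
  have finE: "finite E" using conn_on_finite[OF conn fin] .
  have fin0: "finite V0" "finite E0" using less.prems fin finE finite_subset by blast+
  have "\<exists>V1 E1. V1 \<subseteq> V \<and> E1 \<subseteq> E \<and> E0 \<subset> E1 \<and> conn_on V1 E1 \<and> 2 \<le> card V1 \<and>
      (card V1)\<^sup>2 + 1 < card (csub V1 E1)"
  proof (cases "V0 = V")
    case True
    then obtain u v where uv: "(u, v) \<in> E" "(u, v) \<notin> E0" using less.prems by auto
    have "card (csub V E0) < card (csub V (E0 \<union> {(u, v), (v, u)}))"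
      using uv EV fin fin0 by (intro card_csub_insert_edge) auto
    moreover have "conn_on V (E0 \<union> {(u, v), (v, u)})"
      by (rule conn_on_mono[of V E0]) (use less.prems uv EV True in \<open>auto simp: conn_on_def sym_def\<close>)
    moreover have "E0 \<union> {(u, v), (v, u)} \<subseteq> E" using uv less.prems symE by (auto dest: symD)
    ultimately show ?thesis using less.prems uv True
      by (intro exI[of _ V] exI[of _ "E0 \<union> {(u, v), (v, u)}"]) auto
  next
    case False
    obtain a b where ab: "a \<in> V0" "b \<in> V0" "a \<noteq> b"
      using \<open>2 \<le> card V0\<close> card_le_Suc0_iff_eq[OF fin0(1)] by auto
    obtain p l where p: "1 \<le> l" "inj_on p {0..Suc l}" "p 0 \<in> V0" "p (Suc l) \<in> V0"
      "p ` {1..l} \<subseteq> V - V0" "path_arcs p {0..l} \<subseteq> E"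
      using ear_exists[OF conn less.prems(1) False ab no_cut] by metis
    define V1 where "V1 = V0 \<union> p ` {1..l}"
    define E1 where "E1 = E0 \<union> path_arcs p {0..l}"
    have E0: "E0 \<noteq> {}" "E0 \<subseteq> V0 \<times> V0"
      using \<open>conn_on V0 E0\<close> ab by (auto simp: conn_on_def)
    have c1: "conn_on V1 E1" unfolding V1_def E1_def by (rule conn_on_ear) (use less.prems p in auto)
    have "card (p ` {1..l}) = l" using p(2) by (subst card_image) (auto intro: inj_on_subset)
    then have cV1: "card V1 = card V0 + l"
      unfolding V1_def using p(5) fin0 by (subst card_Un_disjoint) auto
    have "card (csub V0 E0) + 2 * l * card V0 + l * l + 1 \<le>
      card (csub V1 E1 - {(V1, path_arcs p {0..l})})"
      unfolding V1_def E1_def by (rule card_csub_ear[OF less.prems(3) fin0(1) E0(1) p(1-4)]) (use p(5) in blast)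
    also have "\<dots> \<le> card (csub V1 E1)" by (rule card_Diff1_le)
    finally have "(card V1)\<^sup>2 + 1 < card (csub V1 E1)"
      using less.prems(5) unfolding cV1 by (simp add: power2_eq_square algebra_simps)
    moreover have "V1 \<subseteq> V" "E1 \<subseteq> E" using less.prems p by (auto simp: V1_def E1_def)
    moreover have "E0 \<subset> E1"
    proof -
      \<comment> \<open>The first ear edge is new because \<open>p 1\<close> lies outside
        \<open>V0\<close>; hence the induction measure drops.\<close>
      have "(p 0, p 1) \<in> E1" by (auto simp: E1_def path_arcs_def)
      moreover have "(p 0, p 1) \<notin> E0" using E0(2) p(1,5) by (auto simp: image_subset_iff)
      ultimately show ?thesis by (auto simp: E1_def)
    qed
    ultimately show ?thesis using c1 cV1 less.prems by (intro exI[of _ V1] exI[of _ E1]) auto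
  qed
  then obtain V1 E1 where 1: "V1 \<subseteq> V" "E1 \<subseteq> E" "E0 \<subset> E1" "conn_on V1 E1" "2 \<le> card V1"
      "(card V1)\<^sup>2 + 1 < card (csub V1 E1)" by blast
  show ?case
  proof (cases "(V1, E1) = (V, E)")
    case True
    then show ?thesis using 1 by simp
  next
    case False
    have "card (E - E1) < card (E - E0)" using 1 finE by (intro psubset_card_mono) auto
    then show ?thesis by (rule less.hyps) (use 1 False in auto)
  qed
qed

section \<open>The lower bound and its equality case\<close>

text \<open>The cycle on \<open>l + 2\<close> vertices, split into a closing edge and an ear with
  \<open>l\<close> inner vertices.\<close>

definition cycle_arcs :: "(nat \<Rightarrow> 'a) \<Rightarrow> nat \<Rightarrow> 'a rel" where
  "cycle_arcs p l = {(p 0, p (Suc l)), (p (Suc l), p 0)} \<union> path_arcs p {0..l}"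

text \<open>Close an edge to a cycle by a first ear. If the cycle is the whole graph, this is the
  equality case; otherwise further edges or ears make the bound strict.\<close>

lemma card_csub_cut_free:
  assumes conn: "conn_on V E" and fin: "finite V" and "3 \<le> card V"
    and no_cut: "cut_free V E"
  shows "(card V)\<^sup>2 + 1 \<le> card (csub V E) \<and>
    ((card V)\<^sup>2 + 1 = card (csub V E) \<longrightarrow>
    (\<exists>p l. inj_on p {0..Suc l} \<and> V = p ` {0..Suc l} \<and> E = cycle_arcs p l))"
proof -
  have EV: "E \<subseteq> V \<times> V" and symE: "sym E" using conn by (auto simp: conn_on_def)
  obtain r s where rs: "r \<in> V" "s \<in> V" "r \<noteq> s"
    using \<open>3 \<le> card V\<close> card_le_Suc0_iff_eq[OF fin] by auto
  obtain a b where ab: "(a, b) \<in> E" "a \<noteq> b"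
    using conn_on_crossing[OF conn rs(1) _ rs(2), of "{r}"] rs by (metis insertCI singletonD)
  have ba: "(b, a) \<in> E" using symE ab by (auto dest: symD)
  define V0 where "V0 = {a, b}"
  define E0 where "E0 = {(a, b), (b, a)}"
  have V0: "card V0 = 2" "V0 \<subseteq> V" "finite V0" using ab EV by (auto simp: V0_def)
  have "V0 \<noteq> V" using V0 \<open>3 \<le> card V\<close> by auto
  have abV: "a \<in> V0" "b \<in> V0" by (auto simp: V0_def)
  obtain p l where p: "1 \<le> l" "inj_on p {0..Suc l}" "p 0 \<in> V0" "p (Suc l) \<in> V0"
    "p ` {1..l} \<subseteq> V - V0" "path_arcs p {0..l} \<subseteq> E"
    using ear_exists[OF conn V0(2) \<open>V0 \<noteq> V\<close> abV ab(2) no_cut] by metis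
  have "p 0 \<noteq> p (Suc l)" using p(2) by (auto dest: inj_onD)
  then have pe: "V0 = {p 0, p (Suc l)}" "E0 = {(p 0, p (Suc l)), (p (Suc l), p 0)}"
    using p(3,4) by (auto simp: V0_def E0_def)
  have c0: "conn_on V0 E0" unfolding V0_def E0_def by (rule conn_on_edge)
  define V1 where "V1 = V0 \<union> p ` {1..l}"
  define E1 where "E1 = E0 \<union> path_arcs p {0..l}"
  have V1: "V1 = p ` {0..Suc l}"
  proof -
    have "{0..Suc l} = {0, Suc l} \<union> {1..l}" by auto
    then show ?thesis by (auto simp: V1_def pe)
  qed
  have E1: "E1 = cycle_arcs p l" by (auto simp: E1_def pe cycle_arcs_def)
  have c1: "conn_on V1 E1" unfolding V1_def E1_def by (rule conn_on_ear) (use c0 p in auto)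
  have card1: "card V1 = l + 2" unfolding V1 using p(2) by (simp add: card_image)
  have "3 \<le> card (csub V0 E0)"
  proof -
    have "{({a}, {}), ({b}, {}), (V0, E0)} \<subseteq> csub V0 E0"
      using c0 by (auto simp: csub_def V0_def conn_on_singleton)
    moreover have "card {({a}, {}), ({b}, {}), (V0, E0)} = 3" using ab by (auto simp: E0_def card_insert_if)
    moreover have "finite (csub V0 E0)" by (rule finite_csub) (auto simp: V0_def E0_def)
    ultimately show ?thesis by (metis card_mono)
  qed
  moreover have "card (csub V0 E0) + 2 * l * card V0 + l * l + 1 \<le>
      card (csub V1 E1 - {(V1, path_arcs p {0..l})})"
    unfolding V1_def E1_def by (rule card_csub_ear[OF c0 V0(3) _ p(1-4)]) (use p(5) in \<open>auto simp: E0_def image_subset_iff\<close>)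
  \<comment> \<open>Over a single edge the pair left out of the ear count is the spanning path of
    the cycle. With it the total is at least \<open>3 + 4 * l + l * l + 1 + 1\<close>, that is,
    \<open>(l + 2) * (l + 2) + 1\<close>.\<close>
  moreover have "(V1, path_arcs p {0..l}) \<in> csub V1 E1"
    using conn_on_path[of 0 "Suc l" p]
    by (auto simp: csub_def V1 E1_def atLeastLessThanSuc_atLeastAtMost)
  moreover have "finite (csub V1 E1)"
    by (rule finite_csub) (auto simp: V1_def E1_def V0_def E0_def path_arcs_def)
  ultimately have le: "(card V1)\<^sup>2 + 1 \<le> card (csub V1 E1)"
    using V0(1) card1 by (simp add: card_Diff_singleton power2_eq_square)
  show ?thesis
  proof (cases "(V1, E1) = (V, E)")
    case True
    then show ?thesis using le V1 E1 p by blast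
  next
    case False
    have "(card V)\<^sup>2 + 1 < card (csub V E)"
      by (rule card_csub_gt_if_proper_subgraph[OF conn fin no_cut _ _ c1])
        (use False le card1 V0 p ab ba in \<open>auto simp: V1_def E1_def E0_def\<close>)
    then show ?thesis by simp
  qed
qed

section \<open>The cycle\<close>

lemma add_mod_surj:
  fixes s a n :: nat
  assumes "s < n" "a < n"
  shows "\<exists>k<n. (s + k) mod n = a"
proof (cases "s \<le> a")
  case True
  then show ?thesis using assms by (intro exI[of _ "a - s"]) auto
next
  case False
  then show ?thesis using assms by (intro exI[of _ "a + n - s"]) auto
qed

text \<open>The edges of the cycle may be numbered starting from any vertex
  \<open>s\<close>.\<close>

lemma cycle_arc_shift:
  assumes "s < n" "(u, v) \<in> parcs (cycle_graph n)"
  obtains k where "k < n" "(u, v) \<in> path_arcs (\<lambda>i. (s + i) mod n) {k}"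
proof -
  have "u < n" "v < n" "v = Suc u mod n \<or> u = Suc v mod n"
    using assms(2) by (auto simp: cycle_graph_def)
  then consider "v = Suc u mod n" "u < n" | "u = Suc v mod n" "v < n" by blast
  then show ?thesis
  proof cases
    case 1
    obtain k where "k < n" "(s + k) mod n = u" using add_mod_surj[OF assms(1) 1(2)] by blast
    then show ?thesis using 1 by (intro that[of k]) (auto simp: path_arcs_def mod_Suc_eq)
  next
    case 2
    obtain k where "k < n" "(s + k) mod n = v" using add_mod_surj[OF assms(1) 2(2)] by blast
    then show ?thesis using 2 by (intro that[of k]) (auto simp: path_arcs_def mod_Suc_eq)
  qed
qed

text \<open>A proper connected subgraph lacks the edge entering some vertex \<open>s\<close> of
  \<open>W\<close>. Numbered from \<open>s\<close>, it runs up to its first missing edge, and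
  connectedness forbids anything beyond.\<close>

lemma csub_cycle_graph_path:
  assumes n: "3 \<le> n" and WF: "(W, F) \<in> csub (pverts (cycle_graph n)) (parcs (cycle_graph n))"
    and ne: "(W, F) \<noteq> (pverts (cycle_graph n), parcs (cycle_graph n))"
  shows "\<exists>s<n. \<exists>k<n. (W, F) = ((\<lambda>i. (s + i) mod n) ` {0..k}, path_arcs (\<lambda>i. (s + i) mod n) {0..<k})"
proof -
  let ?V = "pverts (cycle_graph n)" and ?E = "parcs (cycle_graph n)"
  have V: "?V = {..<n}" by (simp add: cycle_graph_def)
  have W: "W \<subseteq> {..<n}" "F \<subseteq> ?E" "conn_on W F" and F: "F \<subseteq> W \<times> W" "sym F" "W \<noteq> {}"
    using WF V by (auto simp: csub_def conn_on_def)
  have "\<exists>r<n. \<exists>s\<in>W. s = Suc r mod n \<and> (r, s) \<notin> F"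
  proof (rule ccontr)
    assume "\<not> ?thesis"
    then have closed: "(r, Suc r mod n) \<in> F" if "r < n" "Suc r mod n \<in> W" for r using that by blast
    obtain w where w: "w \<in> W" using F by blast
    then have "w < n" using W by auto
    \<comment> \<open>If no entering edge is missing, going backwards from \<open>w\<close>, which
      is the case \<open>i = n\<close>, reaches every vertex.\<close>
    have pre: "(w + i) mod n \<in> W" if "i \<le> n" for i
      using that
    proof (induction rule: inc_induct)
      case base
      then show ?case using w \<open>w < n\<close> by simp
    next
      case (step m)
      have "((w + m) mod n, Suc ((w + m) mod n) mod n) \<in> F"
        using step n by (intro closed) (auto simp: mod_Suc_eq)
      then show ?case using F by auto
    qed
    have full: "v \<in> W" if "v < n" for v
      using add_mod_surj[OF \<open>w < n\<close> that] pre by (metis less_imp_le)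
    have "?E \<subseteq> F"
    proof clarify
      fix u v assume "(u, v) \<in> ?E"
      then have "u < n" "v < n" "v = Suc u mod n \<or> u = Suc v mod n" by (auto simp: cycle_graph_def)
      then show "(u, v) \<in> F" using closed full F(2) by (metis symD)
    qed
    then show False using ne full W V by auto
  qed
  then obtain r s where rs: "r < n" "s \<in> W" "s = Suc r mod n" "(r, s) \<notin> F" by blast
  define p where "p = (\<lambda>i. (s + i) mod n)"
  have sn: "s < n" using rs W by auto
  have pinj: "i = j" if "p i = p j" "i < n" "j < n" for i j
  proof -
    have "(s + m) mod n = (if s + m < n then s + m else s + m - n)" if "m < n" for m
      using that sn by (auto simp: le_mod_geq)
    then show ?thesis using that by (auto simp: p_def split: if_splits)
  qed
  have pn: "p n = s" "p 0 = s" using sn by (auto simp: p_def)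
  have pn1: "p (n - 1) = r"
  proof -
    obtain m where m: "m < n" "p m = r" using add_mod_surj[OF sn rs(1)] by (auto simp: p_def)
    have "p (Suc m) = Suc (p m) mod n" by (simp add: p_def mod_Suc_eq)
    then have "p (Suc m) = p 0" using m rs(3) pn by simp
    then have "\<not> Suc m < n" using pinj[of "Suc m" 0] by auto
    then have "m = n - 1" using m by simp
    then show ?thesis using m by simp
  qed
  have "Suc (n - 1) = n" using n by simp
  \<comment> \<open>The edge numbered \<open>n - 1\<close> closes the cycle from \<open>r\<close> to
    \<open>s\<close> and is missing, so a first missing index exists.\<close>
  then have last: "(p (n - 1), p (Suc (n - 1))) \<notin> F" using pn(1) pn1 rs(4) by metis
  have Fpath: "\<exists>k<n-1. (u, v) \<in> path_arcs p {k} \<and> (p k, p (Suc k)) \<in> F" if uv: "(u, v) \<in> F" for u v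
  proof -
    have "(u, v) \<in> ?E" using uv W by auto
    then obtain k where k: "k < n" "(u, v) \<in> path_arcs p {k}"
      using cycle_arc_shift[OF sn] unfolding p_def by blast
    have kF: "(p k, p (Suc k)) \<in> F" using k(2) uv F(2) by (auto simp: path_arcs_def dest: symD)
    have "k \<noteq> n - 1" using kF last by blast
    then show ?thesis using k kF by (intro exI[of _ k]) auto
  qed
  define k where "k = (LEAST k. (p k, p (Suc k)) \<notin> F)"
  have k: "(p k, p (Suc k)) \<notin> F" "k \<le> n - 1"
    unfolding k_def using last by (rule LeastI, rule Least_le)
  have ltk: "(p i, p (Suc i)) \<in> F" if "i < k" for i using not_less_Least that unfolding k_def by blast
  have pW: "p i \<in> W" if "i \<le> k" for i
    using that ltk[of "i - 1"] F(1) pn(2) rs(2) by (cases i) auto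
  \<comment> \<open>An edge of \<open>F\<close> at a vertex numbered at most \<open>k\<close> has
    index at most \<open>k\<close>, and index \<open>k\<close> itself is missing; so the initial
    segment is closed under \<open>F\<close>.\<close>
  have arcs: "\<exists>i<k. (u, v) \<in> path_arcs p {i}" if uv: "(u, v) \<in> F" "u \<in> p ` {0..k}" for u v
  proof -
    obtain i where i: "i < n - 1" "(u, v) \<in> path_arcs p {i}" "(p i, p (Suc i)) \<in> F" using Fpath[OF uv(1)] by blast
    then have "u = p i \<or> u = p (Suc i)" by (auto simp: path_arcs_def)
    moreover obtain j where "j \<le> k" and "u = p j" using uv by auto
    moreover have "j < n" "i < n" "Suc i < n" using \<open>j \<le> k\<close> i(1) k(2) n by linarith+
    ultimately have "j = i \<or> j = Suc i" using pinj by metis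
    then have "i \<le> k" using \<open>j \<le> k\<close> by auto
    moreover have "i \<noteq> k" using i k by auto
    ultimately have "i < k" by simp
    then show ?thesis using i(2) by blast
  qed
  have Weq: "W = p ` {0..k}"
  proof
    show "p ` {0..k} \<subseteq> W" using pW by auto
    show "W \<subseteq> p ` {0..k}"
    proof
      fix w assume w: "w \<in> W"
      show "w \<in> p ` {0..k}"
      proof (rule ccontr)
        assume "w \<notin> p ` {0..k}"
        then obtain x y where xy: "x \<in> p ` {0..k}" "y \<notin> p ` {0..k}" "(x, y) \<in> F"
          using conn_on_crossing[OF W(3) rs(2) _ w, of "p ` {0..k}"] pn(2) by (metis atLeastAtMost_iff image_eqI le0)
        then obtain i where "i < k" "(x, y) \<in> path_arcs p {i}" using arcs by blast
        then show False using xy(2) by (auto simp: path_arcs_def)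
      qed
    qed
  qed
  have "F = path_arcs p {0..<k}"
  proof
    show "F \<subseteq> path_arcs p {0..<k}"
    proof clarify
      fix u v assume uv: "(u, v) \<in> F"
      then obtain i where "i < k" "(u, v) \<in> path_arcs p {i}" using arcs F(1) Weq by blast
      then show "(u, v) \<in> path_arcs p {0..<k}" using path_arcs_mono[of "{i}" "{0..<k}" p] by auto
    qed
    show "path_arcs p {0..<k} \<subseteq> F" using ltk F(2) by (force simp: path_arcs_def intro: symD)
  qed
  then have "(W, F) = (p ` {0..k}, path_arcs p {0..<k})" using Weq by simp
  moreover have "k < n" using k(2) n by linarith
  ultimately show ?thesis using sn unfolding p_def by blast
qed

text \<open>There are \<open>n\<close> starts, \<open>n\<close> lengths and the whole cycle.
  Covering suffices, since the matching lower bound comes from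
  \<open>card_csub_cut_free\<close>.\<close>

lemma card_csub_cycle_graph:
  assumes "3 \<le> n"
  shows "card (csub (pverts (cycle_graph n)) (parcs (cycle_graph n))) \<le> n\<^sup>2 + 1"
proof -
  let ?c = "(pverts (cycle_graph n), parcs (cycle_graph n))"
  let ?f = "\<lambda>(s, k). ((\<lambda>i. (s + i) mod n) ` {0..k}, path_arcs (\<lambda>i. (s + i) mod n) {0..<k})"
  have "csub (fst ?c) (snd ?c) \<subseteq> insert ?c (?f ` ({..<n} \<times> {..<n}))"
  proof
    fix H assume H: "H \<in> csub (fst ?c) (snd ?c)"
    obtain W F where WF: "H = (W, F)" by force
    show "H \<in> insert ?c (?f ` ({..<n} \<times> {..<n}))"
    proof (cases "H = ?c")
      case False
      then obtain s k where "s < n" "k < n" "H = ?f (s, k)"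
        using csub_cycle_graph_path[OF assms, of W F] H WF by auto
      then show ?thesis by blast
    qed simp
  qed
  then have "card (csub (fst ?c) (snd ?c)) \<le> card (insert ?c (?f ` ({..<n} \<times> {..<n})))"
    by (intro card_mono) auto
  also have "\<dots> \<le> Suc (card (?f ` ({..<n} \<times> {..<n})))" by (rule card_insert_le_m1) auto
  also have "\<dots> \<le> Suc (card ({..<n} \<times> {..<n}))" using card_image_le[of "{..<n} \<times> {..<n}" ?f] by simp
  finally show ?thesis by (simp add: power2_eq_square)
qed

section \<open>Relabelling vertices\<close>

lemma conn_on_image:
  assumes "conn_on W F"
  shows "conn_on (f ` W) (map_prod f f ` F)"
proof -
  have "(f a, f b) \<in> (map_prod f f ` F)\<^sup>*" if "(a, b) \<in> F\<^sup>*" for a b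
    using that by induction (auto intro: rtrancl_into_rtrancl)
  moreover have "sym (map_prod f f ` F)"
    using assms by (force simp: conn_on_def sym_def)
  ultimately show ?thesis using assms by (auto simp: conn_on_def)
qed

lemma card_csub_le_image:
  assumes "inj_on f V" "E \<subseteq> V \<times> V" "finite V"
  shows "card (csub V E) \<le> card (csub (f ` V) (map_prod f f ` E))"
proof (rule card_inj_on_le)
  let ?g = "\<lambda>(W, F). (f ` W, map_prod f f ` F)"
  have inj2: "inj_on (map_prod f f) (V \<times> V)" using assms(1) by (auto simp: inj_on_def)
  show "inj_on ?g (csub V E)"
  proof (rule inj_onI, clarify)
    fix W F W' F' assume h: "(W, F) \<in> csub V E" "(W', F') \<in> csub V E" "f ` W = f ` W'"
      "map_prod f f ` F = map_prod f f ` F'"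
    then have "W \<subseteq> V" "W' \<subseteq> V" "F \<subseteq> V \<times> V" "F' \<subseteq> V \<times> V" using assms(2) by (auto simp: csub_def)
    then show "W = W' \<and> F = F'"
      using h(3,4) inj_on_image_eq_iff[OF assms(1), of W W'] inj_on_image_eq_iff[OF inj2, of F F'] by simp
  qed
  show "?g ` csub V E \<subseteq> csub (f ` V) (map_prod f f ` E)"
    unfolding csub_def by (auto intro: conn_on_image)
  show "finite (csub (f ` V) (map_prod f f ` E))"
    using assms finite_subset[OF assms(2)] by (intro finite_csub) auto
qed

section \<open>Transfer to pair graphs\<close>

lemma reachable_with_proj_iff:
  assumes "parcs G \<subseteq> pverts G \<times> pverts G" "u \<in> pverts G"
  shows "u \<rightarrow>\<^sup>*\<^bsub>with_proj G\<^esub> v \<longleftrightarrow> (u, v) \<in> (parcs G)\<^sup>*"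
proof
  assume "u \<rightarrow>\<^sup>*\<^bsub>with_proj G\<^esub> v"
  then show "(u, v) \<in> (parcs G)\<^sup>*"
    by (auto simp: reachable_def dest: rtrancl_on_rtranclI)
next
  assume "(u, v) \<in> (parcs G)\<^sup>*"
  then have "(u, v) \<in> rtrancl_on (pverts G) (parcs G)"
    by induction (use assms in \<open>auto intro: rtrancl_on_into_rtrancl_on\<close>)
  then show "u \<rightarrow>\<^sup>*\<^bsub>with_proj G\<^esub> v" by (simp add: reachable_def)
qed

text \<open>\<open>connected\<close> refers to the symmetric closure of the digraph, which changes
  nothing for symmetric arcs.\<close>

lemma connected_with_proj_iff:
  assumes "parcs G \<subseteq> pverts G \<times> pverts G" "sym (parcs G)"
  shows "connected (with_proj G) \<longleftrightarrow> conn_on (pverts G) (parcs G)"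
proof -
  have "mk_symmetric (with_proj G) = \<lparr>pverts = pverts G, parcs = parcs G\<rparr>"
    using assms(2) by (auto simp: mk_symmetric_def dest: symD)
  then have "mk_symmetric (with_proj G) = G" by simp
  then show ?thesis
    using assms reachable_with_proj_iff[OF assms(1)]
    by (auto simp: connected_def strongly_connected_def conn_on_def)
qed

lemma pair_graphD:
  assumes "pair_graph G"
  shows "finite (pverts G)" "parcs G \<subseteq> pverts G \<times> pverts G" "sym (parcs G)" "irrefl (parcs G)"
proof -
  interpret pair_graph G by fact
  show "finite (pverts G)" by (rule pair_finite_verts)
  show "parcs G \<subseteq> pverts G \<times> pverts G" using in_arcsD1 in_arcsD2 by auto
  show "sym (parcs G)" using pair_sym_arcs by (simp add: symmetric_def)
  show "irrefl (parcs G)" using pair_no_loops by (force simp: irrefl_def)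
qed

text \<open>A pair graph is determined by its vertex and arc sets, and subgraphs inherit finiteness
  and absence of loops.\<close>

lemma core_index_eq_card_csub:
  fixes G :: "'a pair_pre_digraph"
  assumes "pair_graph G"
  shows "core_index G = card (csub (pverts G) (parcs G))"
proof -
  note G = pair_graphD[OF assms]
  let ?f = "\<lambda>H :: 'a pair_pre_digraph. (pverts H, parcs H)"
  have inj: "inj ?f" by (rule injI) (rule pair_pre_digraph.equality, auto)
  have "?f ` connected_subgraphs G = csub (pverts G) (parcs G)"
  proof (rule set_eqI, clarify)
    fix W :: "'a set" and F :: "'a rel"
    let ?H = "\<lparr>pverts = W, parcs = F\<rparr>"
    have "(W, F) \<in> ?f ` connected_subgraphs G \<longleftrightarrow> ?H \<in> connected_subgraphs G"
      using inj_image_mem_iff[OF inj, of ?H] by simp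
    also have "\<dots> \<longleftrightarrow> (W, F) \<in> csub (pverts G) (parcs G)"
    proof
      assume H: "?H \<in> connected_subgraphs G"
      then have "pair_graph ?H" by (simp add: connected_subgraphs_def)
      note H' = pair_graphD[OF this]
      show "(W, F) \<in> csub (pverts G) (parcs G)"
        using H connected_with_proj_iff[OF H'(2,3)]
        by (auto simp: connected_subgraphs_def csub_def subgraph_def)
    next
      assume c: "(W, F) \<in> csub (pverts G) (parcs G)"
      then have WF: "W \<subseteq> pverts G" "F \<subseteq> parcs G" "conn_on W F" "F \<subseteq> W \<times> W" "sym F"
        by (auto simp: csub_def conn_on_def)
      have fin: "finite W" "finite F"
        using WF G(1) finite_subset conn_on_finite by metis+
      have "pair_graph ?H"
        using WF fin G(4) by unfold_locales (auto simp: symmetric_def irrefl_def)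
      moreover have "subgraph (with_proj ?H) (with_proj G)"
        using WF assms \<open>pair_graph ?H\<close>
        by (auto simp: subgraph_def compatible_def wf_digraph_wp_iff pair_graph_def pair_digraph_def pair_fin_digraph_def)
      moreover have "connected (with_proj ?H)"
        using WF by (subst connected_with_proj_iff) auto
      ultimately show "?H \<in> connected_subgraphs G" by (simp add: connected_subgraphs_def)
    qed
    finally show "(W, F) \<in> ?f ` connected_subgraphs G \<longleftrightarrow> (W, F) \<in> csub (pverts G) (parcs G)" .
  qed
  then show ?thesis
    unfolding core_index_def using card_image[OF inj_on_subset[OF inj subset_UNIV]] by metis
qed

section \<open>Isomorphisms as vertex maps\<close>

text \<open>Tail and head are \<open>fst\<close> and \<open>snd\<close> on both sides, so the vertex
  map forces the arc map.\<close>

lemma digraph_iso_with_projD: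
  assumes "digraph_iso (with_proj G) (with_proj H)"
  obtains f where "inj_on f (pverts G)" "pverts H = f ` pverts G" "parcs H = map_prod f f ` parcs G"
proof -
  obtain h where h: "pre_digraph.digraph_isomorphism (with_proj G) h" "with_proj H = app_iso h (with_proj G)"
    using assms by (auto simp: digraph_iso_def)
  have tl: "iso_tail h = fst" "iso_head h = snd"
    using arg_cong[OF h(2), of tail] arg_cong[OF h(2), of head] by simp_all
  have "iso_arcs h a = map_prod (iso_verts h) (iso_verts h) a" if "a \<in> parcs G" for a
    using h(1) that tl by (auto simp: pre_digraph.digraph_isomorphism_def prod_eq_iff)
  moreover have "pverts H = iso_verts h ` pverts G" "parcs H = iso_arcs h ` parcs G"
    using arg_cong[OF h(2), of verts] arg_cong[OF h(2), of arcs] by simp_all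
  moreover have "inj_on (iso_verts h) (pverts G)"
    using h(1) by (simp add: pre_digraph.digraph_isomorphism_def)
  ultimately show ?thesis by (intro that[of "iso_verts h"]) auto
qed

lemma digraph_iso_with_projI:
  assumes "parcs G \<subseteq> pverts G \<times> pverts G" "inj_on f (pverts G)"
    and "pverts H = f ` pverts G" "parcs H = map_prod f f ` parcs G"
  shows "digraph_iso (with_proj G) (with_proj H)"
proof -
  let ?h = "\<lparr>iso_verts = f, iso_arcs = map_prod f f, iso_head = snd, iso_tail = fst\<rparr>"
  have "inj_on (map_prod f f) (pverts G \<times> pverts G)" using assms(2) by (auto simp: inj_on_def)
  then have "inj_on (map_prod f f) (parcs G)" using assms(1) by (rule inj_on_subset)
  moreover have "wf_digraph (with_proj G)" using assms(1) by unfold_locales auto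
  ultimately have "pre_digraph.digraph_isomorphism (with_proj G) ?h"
    using assms(2) by (auto simp: pre_digraph.digraph_isomorphism_def)
  moreover have "with_proj H = app_iso ?h (with_proj G)"
    using assms(3,4) by (simp add: app_iso_def with_proj_def)
  ultimately show ?thesis by (auto simp: digraph_iso_def)
qed

lemma parcs_cycle_graph_eq: "parcs (cycle_graph (l + 2)) = cycle_arcs (\<lambda>i. i) l"
proof -
  \<comment> \<open>Successor on the cycle without \<open>mod\<close>, the wrap-around being a
    separate case.\<close>
  define R where "R u v \<longleftrightarrow> u \<le> l \<and> v = Suc u \<or> u = Suc l \<and> v = 0" for u v
  have "u < l + 2 \<and> v < l + 2 \<and> v = Suc u mod (l + 2) \<longleftrightarrow> R u v" for u v
    by (cases "u = Suc l") (auto simp: R_def)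
  then have "(u, v) \<in> parcs (cycle_graph (l + 2)) \<longleftrightarrow> R u v \<or> R v u" for u v
    unfolding cycle_graph_def by fastforce
  moreover have "(u, v) \<in> cycle_arcs (\<lambda>i. i) l \<longleftrightarrow> R u v \<or> R v u" for u v
    by (auto simp: cycle_arcs_def path_arcs_def R_def)
  ultimately show ?thesis by auto
qed

lemma image_cycle_arcs: "map_prod f f ` cycle_arcs p l = cycle_arcs (f \<circ> p) l"
  by (simp add: cycle_arcs_def path_arcs_def image_Un image_UN)

lemma digraph_iso_cycle_graph:
  assumes "inj_on p {0..Suc l}" "pverts G = p ` {0..Suc l}" "parcs G = cycle_arcs p l"
  shows "digraph_iso (with_proj G) (with_proj (cycle_graph (l + 2)))"
proof -
  have V: "pverts (cycle_graph (l + 2)) = {0..Suc l}" by (auto simp: cycle_graph_def)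
  have E: "parcs (cycle_graph (l + 2)) \<subseteq> pverts (cycle_graph (l + 2)) \<times> pverts (cycle_graph (l + 2))"
    by (auto simp: cycle_graph_def)
  have "parcs G = map_prod p p ` parcs (cycle_graph (l + 2))"
    by (simp only: assms(3) parcs_cycle_graph_eq image_cycle_arcs comp_def)
  then have "digraph_iso (with_proj (cycle_graph (l + 2))) (with_proj G)"
    using assms(1,2) V by (intro digraph_iso_with_projI[OF E, of p]) simp_all
  moreover have "wf_digraph (with_proj (cycle_graph (l + 2)))" using E by unfold_locales auto
  ultimately show ?thesis by (rule digraph_iso_swap[rotated])
qed

text \<open>Connectedness provides the reachability in \<open>G\<close> that
  \<open>cut_vertex\<close> presupposes, so the absence of cut-vertices keeps \<open>u\<close> and
  \<open>w\<close> joined after deleting \<open>x\<close>.\<close>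

lemma two_connected_cut_free:
  assumes "pair_graph G" "two_connected G"
  shows "cut_free (pverts G) (parcs G)"
  unfolding cut_free_def
proof (intro ballI)
  fix x u w assume x: "x \<in> pverts G" "u \<in> pverts G - {x}" "w \<in> pverts G - {x}"
  note G = pair_graphD[OF assms(1)]
  let ?D = "pre_digraph.del_vert (with_proj G) x"
  have "conn_on (pverts G) (parcs G)"
    using assms(2) connected_with_proj_iff[OF G(2,3)] by (simp add: two_connected_def)
  then have "u \<rightarrow>\<^sup>*\<^bsub>with_proj G\<^esub> w" using x reachable_with_proj_iff[OF G(2)] by (simp add: conn_on_def)
  then have "u \<rightarrow>\<^sup>*\<^bsub>?D\<^esub> w" using assms(2) x unfolding two_connected_def cut_vertex_def by blast
  then have "(u, w) \<in> (arcs_ends ?D)\<^sup>*"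
    by (auto simp: reachable_def dest: rtrancl_on_rtranclI)
  moreover have "arcs_ends ?D \<subseteq> parcs G \<inter> (pverts G - {x}) \<times> (pverts G - {x})"
    using G(2) by (auto simp: arcs_ends_conv pre_digraph.del_vert_simps)
  ultimately show "(u, w) \<in> (parcs G \<inter> (pverts G - {x}) \<times> (pverts G - {x}))\<^sup>*"
    using rtrancl_mono by blast
qed

theorem theorem5p15:
  fixes G :: "'a pair_pre_digraph" and n :: nat
  assumes "pair_graph G"
    and "two_connected G"
    and "card (pverts G) = n"
    and "n \<ge> 5"
  shows "core_index G \<ge> core_index (cycle_graph n) \<and>
    (core_index G = core_index (cycle_graph n) \<longleftrightarrow>
       digraph_iso (with_proj G) (with_proj (cycle_graph n)))"
proof -
  note G = pair_graphD[OF assms(1)]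
  have conn: "conn_on (pverts G) (parcs G)"
    using assms(2) connected_with_proj_iff[OF G(2,3)] by (simp add: two_connected_def)
  have "3 \<le> card (pverts G)" using assms by simp
  note lower = card_csub_cut_free[OF conn G(1) this two_connected_cut_free[OF assms(1,2)]]
  \<comment> \<open>Both core indices are compared with \<open>n\<^sup>2 + 1\<close>, which lies
    between them.\<close>
  have ge: "n\<^sup>2 + 1 \<le> core_index G"
    using lower assms(1,3) by (simp add: core_index_eq_card_csub)
  have C: "pair_graph (cycle_graph n)" using assms(4) by (intro pair_graph_cycle_graph) simp
  have le: "core_index (cycle_graph n) \<le> n\<^sup>2 + 1"
    unfolding core_index_eq_card_csub[OF C] using assms(4) by (intro card_csub_cycle_graph) simp
  show ?thesis
  proof (intro conjI iffI)
    show "core_index (cycle_graph n) \<le> core_index G" using ge le by simp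
  next
    assume "core_index G = core_index (cycle_graph n)"
    then have "core_index G = n\<^sup>2 + 1" using ge le by simp
    then obtain p l where p: "inj_on p {0..Suc l}" "pverts G = p ` {0..Suc l}" "parcs G = cycle_arcs p l"
      using lower assms(1,3) by (auto simp: core_index_eq_card_csub)
    have "n = l + 2" using assms(3) p by (simp add: card_image)
    then show "digraph_iso (with_proj G) (with_proj (cycle_graph n))"
      using digraph_iso_cycle_graph[OF p] by simp
  next
    assume "digraph_iso (with_proj G) (with_proj (cycle_graph n))"
    then obtain f where f: "inj_on f (pverts G)" "pverts (cycle_graph n) = f ` pverts G"
        "parcs (cycle_graph n) = map_prod f f ` parcs G"
      by (rule digraph_iso_with_projD)
    \<comment> \<open>The isomorphism carries subgraphs of \<open>G\<close> injectively into the
      cycle; the lower bound gives the reverse inequality.\<close>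
    have "core_index G \<le> core_index (cycle_graph n)"
      using card_csub_le_image[OF f(1) G(2,1)]
      by (simp add: core_index_eq_card_csub assms(1) C f(2,3))
    then show "core_index G = core_index (cycle_graph n)" using ge le by simp
  qed
qed

end
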